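(* Let $\{f_n\}_{n\ge 1}$ and $\{a_n\}_{n\ge 1}$ be sequences of integers. Let $F(x)=\sum_{n>0} f_n x^n$ be the ordinary generating function of $\{f_n\}$, let $R(x)=\sum_{n>0} r_n x^n=\sum_{n>0}\frac{a_n}{n}x^n$ be the logarithmic generating function with $r_n=\frac{a_n}{n}$, and let $G(x)=\sum_{n>0} g_n x^n$ be the composition $G(x)=R(F(x))$. Then for every $n\in\mathbb{N}$ (positive integers) the value $$n g_n = n\sum_{k=1}^{n} F^{\Delta}(n,k)\, r_k = n\sum_{k=1}^{n}\frac{F^{\Delta}(n,k)\,a_k}{k}$$ is an integer, where $F^{\Delta}(n,k)$ is the composita of $F(x)$.
   Context: All generating functions are formal power series (with rational coefficients). For $R(x)=\sum_{n\ge 0} r_n x^n$ and $F(x)=\sum_{n>0} f_n x^n$ (zero constant term), the composition is the well-defined formal power series $R(F(x))=\sum_{n\ge 0} r_n F(x)^n$. The composita of $F(x)=\sum_{n>0} f_n x^n$ is the function of two variables $$F^{\Delta}(n,k)=\sum f_{\lambda_1} f_{\lambda_2}\cdots f_{\lambda_k},$$ where the sum runs over all compositions of $n$ into exactly $k$ parts, i.e. all ordered $k$-tuples $(\lambda_1,\dots,\lambda_k)$ of positive integers with $\lambda_1+\cdots+\lambda_k=n$. Equivalently, $F(x)^k=\sum_{n\ge k}F^{\Delta}(n,k)x^n$. *)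

theory Defs
  imports "HOL-Computational_Algebra.Formal_Power_Series"
begin

text \<open>
  Sequences are indexed by the positive integers; as functions on \<open>nat\<close> their value
  at \<open>0\<close> is ignored, so both generating functions have zero constant term.
\<close>

definition ord_gf :: "(nat \<Rightarrow> int) \<Rightarrow> rat fps" where
  "ord_gf f = Abs_fps (\<lambda>n. if n = 0 then 0 else of_int (f n))"

definition log_gf :: "(nat \<Rightarrow> int) \<Rightarrow> rat fps" where
  "log_gf a = Abs_fps (\<lambda>n. if n = 0 then 0 else of_int (a n) / of_nat n)"

definition compositions :: "nat \<Rightarrow> nat \<Rightarrow> nat list set" where
  "compositions n k = {l. length l = k \<and> sum_list l = n \<and> (\<forall>p \<in> set l. p > 0)}"

lemma finite_compositions: "finite (compositions n k)"
proof (rule finite_subset)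
  show "compositions n k \<subseteq> {l. set l \<subseteq> {..n} \<and> length l = k}"
    by (auto simp: compositions_def intro: member_le_sum_list)
qed (simp add: finite_lists_length_eq)

text \<open>
  Only the coefficients of positive index enter, so the constant term of \<open>F\<close> (which
  is zero in the intended use) plays no role.
\<close>

definition composita :: "rat fps \<Rightarrow> nat \<Rightarrow> nat \<Rightarrow> rat" where
  "composita F n k = (\<Sum>l \<in> compositions n k. prod_list (map (fps_nth F) l))"

end

theory Submission
  imports Defs
begin

text \<open>
  The first two expressions for \<open>n g\<^sub>n\<close> only say that the composita collects the
  coefficients of the powers of \<open>F\<close>. The point is integrality, since \<open>1/k\<close> occurs for every
  \<open>k \<le> n\<close>. Differentiation removes it: comparing coefficients of \<open>x^(n-1)\<close> in
  \<open>(F^k)' = k F^(k-1) F'\<close> gives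
  \<open>n [x^n] F^k = k [x^(n-1)] (F^(k-1) F')\<close>,
  and \<open>F^(k-1) F'\<close> has integer coefficients because \<open>F\<close> has. Hence already each single
  summand \<open>n F\<^sup>\<Delta>(n,k) a\<^sub>k / k\<close> is an integer.
\<close>

text \<open>
  Expanding the power gives a sum over all lists of length \<open>k\<close> with sum \<open>n\<close>, zero entries
  allowed; a vanishing constant term makes the lists with a zero entry contribute nothing.
\<close>
lemma composita_eq_fps_nth_power:
  assumes "fps_nth F 0 = 0"
  shows "composita F n k = fps_nth (F ^ k) n"
proof -
  have "composita F n k = (\<Sum>l\<in>natpermute n k. prod_list (map (fps_nth F) l))"
    unfolding composita_def
  proof (rule sum.mono_neutral_left)
    show "finite (natpermute n k)"
      by (rule natpermute_finite)
    show "compositions n k \<subseteq> natpermute n k"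
      by (auto simp: compositions_def natpermute_def)
    show "\<forall>l\<in>natpermute n k - compositions n k. prod_list (map (fps_nth F) l) = 0"
      using assms by (auto simp: compositions_def natpermute_def prod_list_zero_iff image_iff)
  qed
  also have "\<dots> = fps_nth (F ^ k) n"
  proof (cases k)
    case 0
    then show ?thesis
      by (auto simp: natpermute_0)
  next
    case (Suc m)
    have "prod_list (map (fps_nth F) l) = (\<Prod>j = 0..m. fps_nth F (l ! j))"
      if "l \<in> natpermute n k" for l
      using that Suc
      by (simp add: natpermute_def prod.list_conv_set_nth atLeastLessThanSuc_atLeastAtMost)
    then show ?thesis
      using Suc by (simp add: fps_power_nth_Suc del: power_Suc)
  qed
  finally show ?thesis .
qed

lemma fps_nth_mult_Ints:
  fixes A B :: "'a::ring_1 fps"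
  assumes "\<And>i. fps_nth A i \<in> \<int>" and "\<And>i. fps_nth B i \<in> \<int>"
  shows "fps_nth (A * B) n \<in> \<int>"
  using assms by (simp add: fps_mult_nth Ints_sum Ints_mult)

lemma fps_nth_power_Ints:
  fixes A :: "'a::ring_1 fps"
  assumes "\<And>i. fps_nth A i \<in> \<int>"
  shows "fps_nth (A ^ k) n \<in> \<int>"
proof (induction k arbitrary: n)
  case 0
  show ?case by simp
next
  case (Suc k)
  then show ?case
    using assms by (simp add: fps_nth_mult_Ints)
qed

text \<open>
  The quotient is the coefficient of \<open>x^(n-1)\<close> in \<open>A^(k-1) A'\<close>, by the power rule for
  derivatives.
\<close>
lemma fps_nth_power_div_exponent_Ints:
  fixes A :: "'a::field_char_0 fps"
  assumes A: "\<And>i. fps_nth A i \<in> \<int>" and "n > 0" and "k > 0"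
  shows "of_nat n * fps_nth (A ^ k) n / of_nat k \<in> \<int>"
proof -
  have deriv_int: "fps_nth (fps_deriv A) i \<in> \<int>" for i
    using A[of "Suc i"] by (simp del: of_nat_Suc)
  have "of_nat n * fps_nth (A ^ k) n = fps_nth (fps_deriv (A ^ k)) (n - 1)"
    using \<open>n > 0\<close> by (simp del: of_nat_Suc)
  also have "\<dots> = of_nat k * fps_nth (fps_deriv A * A ^ (k - 1)) (n - 1)"
    by (simp add: fps_deriv_power' fps_of_nat[symmetric] mult.assoc)
  finally have "of_nat n * fps_nth (A ^ k) n / of_nat k
      = fps_nth (fps_deriv A * A ^ (k - 1)) (n - 1)"
    using \<open>k > 0\<close> by simp
  then show ?thesis
    by (simp add: fps_nth_mult_Ints deriv_int fps_nth_power_Ints A)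
qed

theorem theorem3p1:
  fixes f a :: "nat \<Rightarrow> int" and F R G :: "rat fps" and n :: nat
  assumes F: "F = ord_gf f"
    and R: "R = log_gf a"
    and G: "G = fps_compose R F"
    and n: "n > 0"
  shows "of_nat n * fps_nth G n = of_nat n * (\<Sum>k=1..n. composita F n k * fps_nth R k)
    \<and> of_nat n * fps_nth G n = of_nat n * (\<Sum>k=1..n. composita F n k * of_int (a k) / of_nat k)
    \<and> of_nat n * fps_nth G n \<in> \<int>"
proof -
  have F0: "fps_nth F 0 = 0" and R0: "fps_nth R 0 = 0"
    by (simp_all add: F R ord_gf_def log_gf_def)
  have F_int: "fps_nth F i \<in> \<int>" for i
    by (simp add: F ord_gf_def)
  have "fps_nth G n = (\<Sum>k=0..n. fps_nth R k * fps_nth (F ^ k) n)"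
    by (simp add: G fps_compose_nth)
  also have "\<dots> = (\<Sum>k=1..n. composita F n k * fps_nth R k)"
    by (simp add: sum.atLeast_Suc_atMost R0 composita_eq_fps_nth_power[OF F0] mult.commute)
  finally have via_R: "fps_nth G n = (\<Sum>k=1..n. composita F n k * fps_nth R k)" .
  also have "\<dots> = (\<Sum>k=1..n. composita F n k * of_int (a k) / of_nat k)"
    by (rule sum.cong) (simp_all add: R log_gf_def)
  finally have via_a: "fps_nth G n = (\<Sum>k=1..n. composita F n k * of_int (a k) / of_nat k)" .
  have "of_nat n * fps_nth G n
      = (\<Sum>k=1..n. of_int (a k) * (of_nat n * fps_nth (F ^ k) n / of_nat k))"
    by (simp add: via_a sum_distrib_left composita_eq_fps_nth_power[OF F0] mult_ac)
  also have "\<dots> \<in> \<int>"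
    using n by (intro Ints_sum Ints_mult Ints_of_int fps_nth_power_div_exponent_Ints F_int) auto
  finally show ?thesis
    using via_R via_a by metis
qed

end
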